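(* Let $\alpha=(\alpha_1,\ldots,\alpha_k)\in\mathbb{Z}_{>0}^k$ and $n\geq1$. Then $\mathsf{Newton}(F_\alpha(x_1,\ldots,x_n))=\mathsf{Newton}(M_\alpha(x_1,\ldots,x_n))\subset\mathbb{R}^n$, and the vertices of this polytope are exactly the vectors in $\{\gamma\in\mathbb{Z}^n_{\geq0}:\gamma^+=\alpha\}$.
   Context: The monomial quasisymmetric function is $M_\alpha=\sum_{i_1<\cdots<i_k}x_{i_1}^{\alpha_1}\cdots x_{i_k}^{\alpha_k}$. Gessel's fundamental quasisymmetric function is $F_\alpha=\sum_{\beta\to\alpha}M_\beta$, where $\beta\to\alpha$ means that $\alpha$ is obtained from the composition $\beta$ by successively adding adjacent parts (including $\beta=\alpha$). $F_\alpha(x_1,\ldots,x_n)$ denotes the specialization $x_i=0$ for $i>n$. For $\gamma\in\mathbb{Z}^n_{\geq0}$, $\gamma^+$ is the composition obtained by deleting the zero entries of $\gamma$. $\mathsf{Newton}(f)$ is the convex hull of the exponent vectors of $f$. *)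

theory Defs
  imports "HOL-Analysis.Analysis" "HOL-Library.Poly_Mapping"
begin

text \<open>
  A formal power series in the variables \<open>x\<^sub>1, x\<^sub>2, \<dots>\<close> is given by its coefficients: a monomial is a
  finitely supported exponent function \<open>nat \<Rightarrow>\<^sub>0 nat\<close>, where the variables in use have index at
  least 1.
\<close>

type_synonym monomial = "nat \<Rightarrow>\<^sub>0 nat"
type_synonym power_series = "monomial \<Rightarrow> int"

definition composition :: "nat list \<Rightarrow> bool" where
  "composition \<alpha> \<longleftrightarrow> (\<forall>a\<in>set \<alpha>. a > 0)"

text \<open>The index sequences \<open>i\<^sub>1 < \<dots> < i\<^sub>k\<close> whose summand in the definition of \<open>M\<^sub>\<alpha>\<close> is the monomial \<open>m\<close>.\<close>

definition index_seqs :: "nat list \<Rightarrow> monomial \<Rightarrow> nat list set" where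
  "index_seqs \<alpha> m =
     {is. length is = length \<alpha> \<and> (\<forall>i\<in>set is. 1 \<le> i) \<and> sorted_wrt (<) is \<and>
          sum_list (map2 Poly_Mapping.single is \<alpha>) = m}"

text \<open>The coefficient of \<open>m\<close> in the infinite sum of monomials defining \<open>M\<^sub>\<alpha>\<close> is the number of
  summands equal to \<open>m\<close>; \<open>finite_index_seqs\<close> below shows that this is a finite number.\<close>

definition monomial_qsym :: "nat list \<Rightarrow> power_series" where
  "monomial_qsym \<alpha> = (\<lambda>m. int (card (index_seqs \<alpha> m)))"

inductive add_adjacent :: "nat list \<Rightarrow> nat list \<Rightarrow> bool" where
  "add_adjacent (xs @ a # b # ys) (xs @ (a + b) # ys)"

definition refinements :: "nat list \<Rightarrow> nat list set" where
  "refinements \<alpha> = {\<beta>. composition \<beta> \<and> add_adjacent\<^sup>*\<^sup>* \<beta> \<alpha>}"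

definition fundamental_qsym :: "nat list \<Rightarrow> power_series" where
  "fundamental_qsym \<alpha> = (\<lambda>m. \<Sum>\<beta>\<in>refinements \<alpha>. monomial_qsym \<beta> m)"

text \<open>Setting \<open>x\<^sub>i = 0\<close> for \<open>i > n\<close>.\<close>

definition specialize :: "nat \<Rightarrow> power_series \<Rightarrow> power_series" where
  "specialize n f = (\<lambda>m. if \<forall>i\<in>Poly_Mapping.keys m. i \<le> n then f m else 0)"

text \<open>
  The space \<open>\<real>\<^sup>n\<close> is \<open>real ^ 'n\<close> together with a numbering \<open>pos :: 'n \<Rightarrow> nat\<close> of its coordinates, a
  bijection onto \<open>{1..n}\<close>: the coordinate \<open>j\<close> belongs to the variable with index \<open>pos j\<close>.
\<close>

definition exponent_vector :: "('n::finite \<Rightarrow> nat) \<Rightarrow> monomial \<Rightarrow> real ^ 'n" where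
  "exponent_vector pos m = (\<chi> j. real (Poly_Mapping.lookup m (pos j)))"

definition newton :: "('n::finite \<Rightarrow> nat) \<Rightarrow> power_series \<Rightarrow> (real ^ 'n) set" where
  "newton pos f = convex hull (exponent_vector pos ` {m. f m \<noteq> 0})"

text \<open>The composition \<open>\<gamma>\<^sup>+\<close>; the \<open>i\<close>-th entry of \<open>\<gamma>\<close> is the coordinate that \<open>pos\<close> maps to \<open>i\<close>.\<close>

definition delete_zeros :: "('n::finite \<Rightarrow> nat) \<Rightarrow> nat ^ 'n \<Rightarrow> nat list" where
  "delete_zeros pos \<gamma> = filter (\<lambda>a. a \<noteq> 0) (map (\<lambda>i. \<gamma> $ inv pos i) [1..<Suc CARD('n)])"

lemma keys_sum_list_single:
  fixes "is" :: "nat list"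
  assumes "length is = length \<alpha>" and "composition \<alpha>"
  shows "Poly_Mapping.keys (sum_list (map2 Poly_Mapping.single is \<alpha>)) = set is"
  using assms
proof (induction "is" \<alpha> rule: list_induct2)
  case (Cons i "is" a \<alpha>)
  have keys_add: "Poly_Mapping.keys (p + q) = Poly_Mapping.keys p \<union> Poly_Mapping.keys q"
    for p q :: monomial
    by (auto simp: in_keys_iff lookup_add)
  show ?case using Cons by (auto simp: keys_add composition_def)
qed simp

lemma finite_index_seqs:
  assumes "composition \<alpha>"
  shows "finite (index_seqs \<alpha> m)"
proof (rule finite_subset)
  show "index_seqs \<alpha> m \<subseteq> {is. set is \<subseteq> Poly_Mapping.keys m \<and> length is = length \<alpha>}"
    using keys_sum_list_single[OF _ assms] by (auto simp: index_seqs_def)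
qed (simp add: finite_lists_length_eq)

lemma finite_refinements: "finite (refinements \<alpha>)"
proof (rule finite_subset)
  have "sum_list \<beta> = sum_list \<alpha>" if "add_adjacent\<^sup>*\<^sup>* \<beta> \<alpha>" for \<beta>
    using that by induction (auto elim!: add_adjacent.cases)
  moreover have "length \<beta> \<le> sum_list \<beta>" if "composition \<beta>" for \<beta>
    using that by (induction \<beta>) (auto simp: composition_def)
  moreover have "set \<beta> \<subseteq> {..sum_list \<beta>}" for \<beta> :: "nat list"
    using member_le_sum_list[of _ \<beta>] by blast
  ultimately show "refinements \<alpha> \<subseteq> {\<beta>. set \<beta> \<subseteq> {..sum_list \<alpha>} \<and> length \<beta> \<le> sum_list \<alpha>}"
    unfolding refinements_def by (metis (no_types, lifting) mem_Collect_eq subsetI)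
qed (simp add: finite_lists_length_le)

end

theory Submission imports Defs begin

text \<open>
  If \<open>\<gamma>\<close> has consecutive nonzero entries \<open>a\<close> and \<open>b\<close> at the positions \<open>i\<close> and \<open>j\<close>, then \<open>\<gamma>\<close> is the
  convex combination, with weights \<open>a / (a + b)\<close> and \<open>b / (a + b)\<close>, of the two vectors obtained by
  moving the whole mass \<open>a + b\<close> to \<open>i\<close> or to \<open>j\<close>. Iterating this, the exponent vectors of \<open>M\<^sub>\<beta>\<close>
  with \<open>\<beta> \<rightarrow> \<alpha>\<close> lie in the Newton polytope of \<open>M\<^sub>\<alpha>\<close>. Conversely, two vectors with
  \<open>\<gamma>\<^sup>+ = \<alpha>\<close> have supports of the same size, and each is determined by its support; so the sum of
  the coordinates outside the support of \<open>\<gamma>\<close> vanishes at \<open>\<gamma>\<close> and is positive at every other such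
  vector, which makes \<open>\<gamma>\<close> a vertex.
\<close>

section \<open>Coefficients of the monomial quasisymmetric functions\<close>

lemma filter_map_nonzero:
  "filter (\<lambda>a. a \<noteq> 0) (map g L) = map g (filter (\<lambda>i. g i \<noteq> 0) L)"
  by (simp add: filter_map o_def)

text \<open>Since the indices are distinct, no two summands contribute to the same exponent.\<close>

lemma map_lookup_sum_list_single:
  fixes "is" :: "nat list" and \<alpha> :: "nat list"
  assumes "length is = length \<alpha>" and "distinct is"
  shows "map (Poly_Mapping.lookup (sum_list (map2 Poly_Mapping.single is \<alpha>))) is = \<alpha>"
  using assms
proof (induction "is" \<alpha> rule: list_induct2)
  case (Cons i "is" a \<alpha>)
  have outside: "Poly_Mapping.lookup (sum_list (map2 Poly_Mapping.single js \<beta>)) i = 0"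
    if "length js = length \<beta>" "i \<notin> set js" for js and \<beta> :: "nat list"
    using that by (induction js \<beta> rule: list_induct2) (auto simp: lookup_add lookup_single)
  have "map (Poly_Mapping.lookup (Poly_Mapping.single i a
          + sum_list (map2 Poly_Mapping.single is \<alpha>))) is
      = map (Poly_Mapping.lookup (sum_list (map2 Poly_Mapping.single is \<alpha>))) is"
    using Cons.prems by (auto simp: lookup_add lookup_single when_def)
  moreover have "map (Poly_Mapping.lookup (sum_list (map2 Poly_Mapping.single is \<alpha>))) is = \<alpha>"
    using Cons by simp
  moreover have "Poly_Mapping.lookup (Poly_Mapping.single i a
      + sum_list (map2 Poly_Mapping.single is \<alpha>)) i = a"
    using Cons.hyps Cons.prems outside[of "is" \<alpha>] by (simp add: lookup_add)
  ultimately show ?case by simp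
qed simp

text \<open>Positive parts force the indices to be exactly the keys of \<open>m\<close>, and a
  strictly increasing list is determined by its set. So every coefficient of
  \<open>M\<^sub>\<alpha>\<close> is 0 or 1.\<close>

lemma index_seqs_iff:
  assumes "composition \<alpha>"
  shows "is \<in> index_seqs \<alpha> m \<longleftrightarrow>
    0 \<notin> Poly_Mapping.keys m \<and> is = sorted_list_of_set (Poly_Mapping.keys m) \<and>
    map (Poly_Mapping.lookup m) is = \<alpha>"
proof
  assume "is \<in> index_seqs \<alpha> m"
  then have len: "length is = length \<alpha>" and pos: "\<forall>i\<in>set is. 1 \<le> i"
    and sorted: "sorted_wrt (<) is"
    and m: "m = sum_list (map2 Poly_Mapping.single is \<alpha>)"
    by (auto simp: index_seqs_def)
  have keys: "Poly_Mapping.keys m = set is"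
    using keys_sum_list_single[OF len assms] m by simp
  have "sorted_list_of_set (set is) = is"
    using sorted by (simp add: sorted_list_of_set.idem_if_sorted_distinct strict_sorted_iff)
  moreover have "map (Poly_Mapping.lookup m) is = \<alpha>"
    using map_lookup_sum_list_single[OF len] sorted m by (simp add: strict_sorted_iff)
  ultimately show "0 \<notin> Poly_Mapping.keys m \<and> is = sorted_list_of_set (Poly_Mapping.keys m) \<and>
    map (Poly_Mapping.lookup m) is = \<alpha>"
    using keys pos by auto
next
  assume *: "0 \<notin> Poly_Mapping.keys m \<and> is = sorted_list_of_set (Poly_Mapping.keys m) \<and>
    map (Poly_Mapping.lookup m) is = \<alpha>"
  then have set: "set is = Poly_Mapping.keys m" and sorted: "sorted_wrt (<) is"
    and len: "length is = length \<alpha>"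
    by auto
  let ?s = "sum_list (map2 Poly_Mapping.single is \<alpha>)"
  have keys: "Poly_Mapping.keys ?s = set is"
    using keys_sum_list_single[OF len assms] .
  have "map (Poly_Mapping.lookup ?s) is = map (Poly_Mapping.lookup m) is"
    using map_lookup_sum_list_single[OF len] sorted * by (metis strict_sorted_iff)
  then have on: "Poly_Mapping.lookup ?s i = Poly_Mapping.lookup m i" if "i \<in> set is" for i
    using that by simp
  have "?s = m"
  proof (rule poly_mapping_eqI)
    show "Poly_Mapping.lookup ?s i = Poly_Mapping.lookup m i" for i
      using on[of i] keys set by (metis in_keys_iff)
  qed
  moreover have "\<forall>i\<in>set is. 1 \<le> i"
    using * set by (metis One_nat_def Suc_leI gr0I)
  ultimately show "is \<in> index_seqs \<alpha> m"
    using sorted len by (simp add: index_seqs_def)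
qed

lemma monomial_qsym_nonzero_iff:
  assumes "composition \<alpha>"
  shows "monomial_qsym \<alpha> m \<noteq> 0 \<longleftrightarrow> 0 \<notin> Poly_Mapping.keys m \<and>
    map (Poly_Mapping.lookup m) (sorted_list_of_set (Poly_Mapping.keys m)) = \<alpha>"
proof -
  \<comment> \<open>Finiteness excludes the default value 0 that \<open>card\<close> takes on
    infinite sets.\<close>
  have "monomial_qsym \<alpha> m \<noteq> 0 \<longleftrightarrow> index_seqs \<alpha> m \<noteq> {}"
    using finite_index_seqs[OF assms] by (simp add: monomial_qsym_def)
  also have "\<dots> \<longleftrightarrow> (\<exists>is. is \<in> index_seqs \<alpha> m)"
    by blast
  finally show ?thesis
    by (simp add: index_seqs_iff[OF assms])
qed

text \<open>Reading off all exponents at 1 to \<open>n\<close> and dropping the zeros runs through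
  the sorted keys; this form matches \<open>delete_zeros\<close>. The range \<open>{1..n}\<close>
  combines the exclusion of index 0 with the cutoff made by \<open>specialize\<close>.\<close>

lemma specialize_monomial_qsym_nonzero_iff:
  assumes "composition \<alpha>"
  shows "specialize n (monomial_qsym \<alpha>) m \<noteq> 0 \<longleftrightarrow> Poly_Mapping.keys m \<subseteq> {1..n} \<and>
    filter (\<lambda>a. a \<noteq> 0) (map (Poly_Mapping.lookup m) [1..<Suc n]) = \<alpha>"
proof -
  have "sorted_list_of_set (Poly_Mapping.keys m)
      = filter (\<lambda>i. Poly_Mapping.lookup m i \<noteq> 0) [1..<Suc n]" (is "_ = ?L")
    if "Poly_Mapping.keys m \<subseteq> {1..n}"
  proof -
    have "Poly_Mapping.keys m = set ?L"
      using that by (auto simp: in_keys_iff simp del: upt_Suc)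
    moreover have "sorted_list_of_set (set ?L) = ?L"
      by (intro sorted_list_of_set.idem_if_sorted_distinct sorted_filter distinct_filter)
        (auto simp: sorted_wrt_filter simp del: upt_Suc)
    ultimately show ?thesis by simp
  qed
  moreover have "Poly_Mapping.keys m \<subseteq> {1..n} \<longleftrightarrow>
      0 \<notin> Poly_Mapping.keys m \<and> (\<forall>i\<in>Poly_Mapping.keys m. i \<le> n)"
    by (auto simp: Suc_le_eq intro: gr0I)
  ultimately show ?thesis
    unfolding filter_map_nonzero specialize_def
    using monomial_qsym_nonzero_iff[OF assms, of m] by auto
qed

section \<open>Exponent vectors of the specialized series\<close>

definition real_vec :: "nat ^ 'n \<Rightarrow> real ^ 'n" where
  "real_vec \<gamma> = (\<chi> j. real (\<gamma> $ j))"

lemma real_vec_nth [simp]: "real_vec \<gamma> $ j = real (\<gamma> $ j)"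
  by (simp add: real_vec_def)

text \<open>For a composition \<open>\<beta>\<close> and a numbering \<open>pos\<close> this is the
  set of exponent vectors of \<open>M\<^sub>\<beta>\<close> in \<open>n\<close> variables; for
  \<open>\<alpha>\<close> it is the claimed vertex set.\<close>

definition vecs :: "('n::finite \<Rightarrow> nat) \<Rightarrow> nat list \<Rightarrow> (real ^ 'n) set" where
  "vecs pos \<beta> = real_vec ` {\<gamma>. delete_zeros pos \<gamma> = \<beta>}"

lemma exponent_vectors_monomial_qsym:
  fixes pos :: "'n::finite \<Rightarrow> nat"
  assumes "composition \<alpha>" and bij: "bij_betw pos UNIV {1..n}"
  shows "exponent_vector pos ` {m. specialize n (monomial_qsym \<alpha>) m \<noteq> 0} = vecs pos \<alpha>"
proof -
  have n: "CARD('n) = n"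
    using bij_betw_same_card[OF bij] by simp
  have inv1: "inv pos (pos j) = j" for j
    using bij by (simp add: bij_betw_def)
  have inv2: "pos (inv pos i) = i" if "i \<in> {1..n}" for i
    using that bij by (metis bij_betw_def f_inv_into_f)
  have range: "pos j \<in> {1..n}" for j
    using bij by (auto simp: bij_betw_def)
  have "exponent_vector pos m \<in> vecs pos \<alpha>"
    if "specialize n (monomial_qsym \<alpha>) m \<noteq> 0" for m
  proof -
    define \<gamma> :: "nat ^ 'n" where "\<gamma> = (\<chi> j. Poly_Mapping.lookup m (pos j))"
    have "map (\<lambda>i. \<gamma> $ inv pos i) [1..<Suc n] = map (Poly_Mapping.lookup m) [1..<Suc n]"
      by (rule map_cong) (auto simp: \<gamma>_def inv2 simp del: upt_Suc)
    then have "delete_zeros pos \<gamma> = filter (\<lambda>a. a \<noteq> 0) (map (Poly_Mapping.lookup m) [1..<Suc n])"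
      unfolding delete_zeros_def n by (rule arg_cong)
    then have "delete_zeros pos \<gamma> = \<alpha>"
      using that specialize_monomial_qsym_nonzero_iff[OF assms(1)] by metis
    moreover have "exponent_vector pos m = real_vec \<gamma>"
      by (simp add: exponent_vector_def real_vec_def \<gamma>_def)
    ultimately show ?thesis by (simp add: vecs_def)
  qed
  moreover have "real_vec \<gamma> \<in> exponent_vector pos ` {m. specialize n (monomial_qsym \<alpha>) m \<noteq> 0}"
    if "delete_zeros pos \<gamma> = \<alpha>" for \<gamma>
  proof -
    \<comment> \<open>The cutoff is needed because \<open>inv pos i\<close> is an arbitrary
      coordinate for \<open>i\<close> outside \<open>{1..n}\<close>.\<close>
    define m :: monomial where
      "m = Abs_poly_mapping (\<lambda>i. (\<gamma> $ inv pos i) when i \<in> {1..n})"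
    have lookup: "Poly_Mapping.lookup m = (\<lambda>i. (\<gamma> $ inv pos i) when i \<in> {1..n})"
      unfolding m_def by (rule lookup_Abs_poly_mapping, rule finite_subset[of _ "{1..n}"])
        (auto simp del: neq0_conv)
    have "map (Poly_Mapping.lookup m) [1..<Suc n] = map (\<lambda>i. \<gamma> $ inv pos i) [1..<Suc n]"
      by (rule map_cong) (auto simp: lookup simp del: upt_Suc)
    moreover have "Poly_Mapping.keys m \<subseteq> {1..n}"
      unfolding in_keys_iff lookup subset_iff by (metis (mono_tags) when_neq_zero)
    ultimately have "specialize n (monomial_qsym \<alpha>) m \<noteq> 0"
      using that unfolding specialize_monomial_qsym_nonzero_iff[OF assms(1)] delete_zeros_def n
      by metis
    moreover have "exponent_vector pos m = real_vec \<gamma>"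
      using range by (simp add: exponent_vector_def real_vec_def lookup inv1 vec_eq_iff)
    ultimately show ?thesis by (metis (mono_tags, lifting) image_eqI mem_Collect_eq)
  qed
  ultimately show ?thesis
    by (auto simp: vecs_def)
qed

text \<open>All coefficients of the \<open>M\<^sub>\<beta>\<close> are nonnegative, so nothing
  cancels in the finite sum.\<close>

lemma specialize_fundamental_qsym_nonzero_iff:
  "specialize n (fundamental_qsym \<alpha>) m \<noteq> 0 \<longleftrightarrow>
    (\<exists>\<beta>\<in>refinements \<alpha>. specialize n (monomial_qsym \<beta>) m \<noteq> 0)"
proof -
  have "(\<Sum>\<beta>\<in>refinements \<alpha>. monomial_qsym \<beta> m) \<noteq> 0 \<longleftrightarrow>
      (\<exists>\<beta>\<in>refinements \<alpha>. monomial_qsym \<beta> m \<noteq> 0)"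
    by (subst sum_nonneg_eq_0_iff) (auto simp: finite_refinements monomial_qsym_def)
  then show ?thesis
    by (auto simp: specialize_def fundamental_qsym_def)
qed

lemma exponent_vectors_fundamental_qsym:
  fixes pos :: "'n::finite \<Rightarrow> nat"
  assumes "bij_betw pos UNIV {1..n}"
  shows "exponent_vector pos ` {m. specialize n (fundamental_qsym \<alpha>) m \<noteq> 0}
    = (\<Union>\<beta>\<in>refinements \<alpha>. vecs pos \<beta>)"
proof -
  have "{m. specialize n (fundamental_qsym \<alpha>) m \<noteq> 0}
      = (\<Union>\<beta>\<in>refinements \<alpha>. {m. specialize n (monomial_qsym \<beta>) m \<noteq> 0})"
    by (simp only: specialize_fundamental_qsym_nonzero_iff) blast
  moreover have "exponent_vector pos ` {m. specialize n (monomial_qsym \<beta>) m \<noteq> 0} = vecs pos \<beta>"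
    if "\<beta> \<in> refinements \<alpha>" for \<beta>
    using that assms by (intro exponent_vectors_monomial_qsym) (auto simp: refinements_def)
  ultimately show ?thesis
    by (simp add: image_UN)
qed

section \<open>Adding adjacent parts as a convex combination\<close>

text \<open>Only zeros lie between \<open>i\<close> and \<open>j\<close>, so the merged entry takes
  the same place among the nonzero entries whether it is put at \<open>i\<close> or at
  \<open>j\<close>.\<close>

lemma merge_positions:
  fixes g :: "'i \<Rightarrow> nat"
  assumes "distinct L"
    and L: "filter (\<lambda>i. g i \<noteq> 0) L = is @ i # j # js"
  shows "filter (\<lambda>a. a \<noteq> 0) (map (g(i := g i + g j, j := 0)) L)
      = map g is @ (g i + g j) # map g js"
    and "filter (\<lambda>a. a \<noteq> 0) (map (g(i := 0, j := g i + g j)) L)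
      = map g is @ (g i + g j) # map g js"
proof -
  have dist: "distinct (is @ i # j # js)"
    using assms by (metis distinct_filter)
  have "i \<in> set (filter (\<lambda>i. g i \<noteq> 0) L)" "j \<in> set (filter (\<lambda>i. g i \<noteq> 0) L)"
    unfolding L by simp_all
  then have nz: "g i \<noteq> 0" "g j \<noteq> 0" by simp_all
  \<comment> \<open>Either merge removes exactly one position from the support: \<open>j\<close> in
    the first case, \<open>i\<close> in the second.\<close>
  have drop_one: "filter (\<lambda>x. x \<noteq> k \<and> g x \<noteq> 0) L = filter (\<lambda>x. x \<noteq> k) (is @ i # j # js)" for k
    unfolding L[symmetric] by (simp add: conj_commute)
  have [simp]: "filter (\<lambda>x. x \<noteq> k) xs = xs" if "k \<notin> set xs" for k and xs :: "'i list"
    using that by (auto simp: filter_id_conv)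
  have "filter (\<lambda>x. (g(i := g i + g j, j := 0)) x \<noteq> 0) L = is @ i # js"
  proof -
    have "filter (\<lambda>x. (g(i := g i + g j, j := 0)) x \<noteq> 0) L = filter (\<lambda>x. x \<noteq> j \<and> g x \<noteq> 0) L"
      using dist nz by (intro filter_cong) auto
    then show ?thesis using drop_one[of j] dist by simp
  qed
  then show "filter (\<lambda>a. a \<noteq> 0) (map (g(i := g i + g j, j := 0)) L)
      = map g is @ (g i + g j) # map g js"
    unfolding filter_map_nonzero using dist by auto
  have "filter (\<lambda>x. (g(i := 0, j := g i + g j)) x \<noteq> 0) L = is @ j # js"
  proof -
    have "filter (\<lambda>x. (g(i := 0, j := g i + g j)) x \<noteq> 0) L = filter (\<lambda>x. x \<noteq> i \<and> g x \<noteq> 0) L"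
      using dist nz by (intro filter_cong) auto
    then show ?thesis using drop_one[of i] dist by auto
  qed
  then show "filter (\<lambda>a. a \<noteq> 0) (map (g(i := 0, j := g i + g j)) L)
      = map g is @ (g i + g j) # map g js"
    unfolding filter_map_nonzero using dist by auto
qed

lemma vecs_add_adjacent:
  fixes pos :: "'n::finite \<Rightarrow> nat"
  assumes bij: "bij_betw pos UNIV {1..n}" and "add_adjacent \<beta> \<beta>'"
  shows "vecs pos \<beta> \<subseteq> convex hull (vecs pos \<beta>')"
proof
  fix v assume "v \<in> vecs pos \<beta>"
  then obtain \<gamma> where v: "v = real_vec \<gamma>" and \<gamma>: "delete_zeros pos \<gamma> = \<beta>"
    by (auto simp: vecs_def)
  from assms(2) obtain xs a b ys where \<beta>: "\<beta> = xs @ a # b # ys"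
    and \<beta>': "\<beta>' = xs @ (a + b) # ys"
    by (auto elim: add_adjacent.cases)
  define L where "L = [1..<Suc n]"
  define g where "g = (\<lambda>i. \<gamma> $ inv pos i)"
  have n: "CARD('n) = n"
    using bij_betw_same_card[OF bij] by simp
  have inv1: "inv pos (pos k) = k" for k
    using bij by (simp add: bij_betw_def)
  have inv2: "pos (inv pos i) = i" if "i \<in> {1..n}" for i
    using that bij by (metis bij_betw_def f_inv_into_f)
  \<comment> \<open>Passing from coordinates to functions on positions makes
    \<open>merge_positions\<close> applicable.\<close>
  have dz: "delete_zeros pos (\<chi> k. h (pos k)) = filter (\<lambda>a. a \<noteq> 0) (map h L)"
    for h :: "nat \<Rightarrow> nat"
  proof -
    have "map (\<lambda>i. (\<chi> k. h (pos k)) $ inv pos i) L = map h L"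
      by (rule map_cong) (auto simp: L_def inv2 simp del: upt_Suc)
    then show ?thesis unfolding delete_zeros_def n L_def by (rule arg_cong)
  qed
  have "map g (filter (\<lambda>i. g i \<noteq> 0) L) = xs @ a # b # ys"
    using \<gamma> unfolding \<beta> delete_zeros_def n filter_map_nonzero L_def g_def .
  then obtain "is" i j js where L: "filter (\<lambda>i. g i \<noteq> 0) L = is @ i # j # js"
    and vals: "map g is = xs" "g i = a" "g j = b" "map g js = ys"
    by (auto simp: map_eq_append_conv map_eq_Cons_conv)
  have "distinct L" by (simp add: L_def)
  have "distinct (is @ i # j # js)"
    using \<open>distinct L\<close> L by (metis distinct_filter)
  then have "i \<noteq> j" by auto
  have "i \<in> set (filter (\<lambda>i. g i \<noteq> 0) L)" unfolding L by simp
  \<comment> \<open>The entry at \<open>i\<close> survived the deletion of zeros; hence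
    \<open>a + b\<close> is positive and can be divided by.\<close>
  then have "a > 0" using vals by auto
  define \<gamma>1 :: "nat ^ 'n" where "\<gamma>1 = (\<chi> k. (g(i := a + b, j := 0)) (pos k))"
  define \<gamma>2 :: "nat ^ 'n" where "\<gamma>2 = (\<chi> k. (g(i := 0, j := a + b)) (pos k))"
  have "real_vec \<gamma>1 \<in> vecs pos \<beta>'" "real_vec \<gamma>2 \<in> vecs pos \<beta>'"
    unfolding vecs_def \<gamma>1_def \<gamma>2_def \<beta>' using merge_positions[OF \<open>distinct L\<close> L]
    by (intro imageI CollectI, simp only: dz vals)+
  then have mem: "real_vec \<gamma>1 \<in> convex hull (vecs pos \<beta>')"
      "real_vec \<gamma>2 \<in> convex hull (vecs pos \<beta>')"
    by (auto intro: hull_inc)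
  define s where "s = real a / real (a + b)"
  define t where "t = real b / real (a + b)"
  have sum1: "s + t = 1" and s: "s * real (a + b) = real a" and t: "t * real (a + b) = real b"
    using \<open>a > 0\<close> by (simp_all add: s_def t_def flip: add_divide_distrib)
  have "v = s *\<^sub>R real_vec \<gamma>1 + t *\<^sub>R real_vec \<gamma>2"
  proof -
    have "real (g (pos k)) = s * real ((g(i := a + b, j := 0)) (pos k))
        + t * real ((g(i := 0, j := a + b)) (pos k))" for k
    \<comment> \<open>At \<open>i\<close> and \<open>j\<close> only one of the two vectors is
      nonzero, and its weight scales \<open>a + b\<close> to the entry of \<open>\<gamma>\<close>.
      Elsewhere both agree with \<open>\<gamma>\<close> and the weights sum to 1.\<close>
    proof (cases "pos k = i \<or> pos k = j")
      case True
      then show ?thesis using \<open>i \<noteq> j\<close> s t vals by auto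
    next
      case False
      have "real (g (pos k)) = (s + t) * real (g (pos k))" by (simp add: sum1)
      with False show ?thesis by (simp add: distrib_right)
    qed
    moreover have "v $ k = real (g (pos k))" for k
      by (simp add: v g_def inv1)
    ultimately show ?thesis
      by (simp only: vec_eq_iff vector_add_component vector_scaleR_component real_vec_nth
          \<gamma>1_def \<gamma>2_def vec_lambda_beta real_scaleR_def) blast
  qed
  moreover have "s \<ge> 0" "t \<ge> 0" by (simp_all add: s_def t_def)
  ultimately show "v \<in> convex hull (vecs pos \<beta>')"
    using mem sum1 convexD[OF convex_convex_hull] by blast
qed

text \<open>Induction on the chain of additions, peeling off the first one: a hull that contains a
  set also contains the hull of that set.\<close>

lemma vecs_refinement:
  assumes "bij_betw pos UNIV {1..n}" and "add_adjacent\<^sup>*\<^sup>* \<beta> \<alpha>"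
  shows "vecs pos \<beta> \<subseteq> convex hull (vecs pos \<alpha>)"
  using assms(2)
proof (induction rule: converse_rtranclp_induct)
  case base
  then show ?case by (rule hull_subset)
next
  case (step \<beta> \<beta>')
  have "vecs pos \<beta> \<subseteq> convex hull (vecs pos \<beta>')"
    using assms(1) step.hyps(1) by (rule vecs_add_adjacent)
  also have "\<dots> \<subseteq> convex hull (vecs pos \<alpha>)"
    using step.IH by (simp add: subset_hull)
  finally show ?case .
qed

section \<open>Vertices of the polytope\<close>

text \<open>The support of \<open>h\<close> lies in that of \<open>g\<close>, and equal filtered
  lists make them equally long. So the supports coincide and the values can be compared position by
  position.\<close>

lemma filter_nonzero_inj:
  fixes g h :: "'i \<Rightarrow> 'b::zero"
  assumes eq: "filter (\<lambda>a. a \<noteq> 0) (map g L) = filter (\<lambda>a. a \<noteq> 0) (map h L)"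
    and sub: "\<And>i. i \<in> set L \<Longrightarrow> g i = 0 \<Longrightarrow> h i = 0"
    and "i \<in> set L"
  shows "h i = g i"
proof -
  let ?G = "filter (\<lambda>i. g i \<noteq> 0) L"
  have H: "filter (\<lambda>i. h i \<noteq> 0) L = filter (\<lambda>i. h i \<noteq> 0) ?G"
    using sub by (auto intro!: filter_cong)
  have "map g ?G = map h (filter (\<lambda>i. h i \<noteq> 0) ?G)"
    using eq H by (simp add: filter_map_nonzero)
  moreover from this have "length (filter (\<lambda>i. h i \<noteq> 0) ?G) = length ?G"
    by (metis length_map)
  then have "filter (\<lambda>i. h i \<noteq> 0) ?G = ?G"
    by (metis filter_True length_filter_less nless_le)
  ultimately have "map g ?G = map h ?G" by simp
  then show ?thesis
    using sub[of i] \<open>i \<in> set L\<close> by (cases "g i = 0") auto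
qed

text \<open>Each coordinate is 0 or a part of \<open>\<alpha>\<close>. Finiteness is what the
  extreme point criterion for \<open>insert\<close> asks for.\<close>

lemma finite_vecs:
  assumes "composition \<alpha>" and "bij_betw pos UNIV {1..n}"
  shows "finite (vecs (pos :: 'n::finite \<Rightarrow> nat) \<alpha>)"
proof -
  have n: "CARD('n) = n"
    using bij_betw_same_card[OF assms(2)] by simp
  have "\<gamma> $ j \<in> insert 0 (set \<alpha>)" if "delete_zeros pos \<gamma> = \<alpha>" for \<gamma> and j :: 'n
  proof -
    have "pos j \<in> {1..n}"
      using assms(2) by (auto simp: bij_betw_def)
    then have "\<gamma> $ j = \<gamma> $ inv pos (pos j)" and "pos j \<in> set [1..<Suc n]"
      using assms(2) by (auto simp: bij_betw_def simp del: upt_Suc)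
    then have "\<gamma> $ j \<in> set (map (\<lambda>i. \<gamma> $ inv pos i) [1..<Suc n])"
      by (metis (no_types, lifting) image_eqI list.set_map)
    then show ?thesis
      using that by (auto simp: delete_zeros_def n simp del: upt_Suc)
  qed
  then have "{\<gamma>. delete_zeros pos \<gamma> = \<alpha>} \<subseteq> {\<gamma>. \<forall>j. \<gamma> $ j \<in> insert 0 (set \<alpha>)}"
    by blast
  moreover have "finite {\<gamma> :: nat ^ 'n. \<forall>j. \<gamma> $ j \<in> insert 0 (set \<alpha>)}"
  proof (rule inj_on_finite[of vec_nth])
    show "finite (UNIV \<rightarrow>\<^sub>E insert 0 (set \<alpha>) :: ('n \<Rightarrow> nat) set)"
      by (rule finite_PiE) auto
  qed (auto simp: inj_on_def vec_nth_inject)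
  ultimately show ?thesis
    unfolding vecs_def by (meson finite_imageI finite_subset)
qed

lemma extreme_points_vecs:
  fixes pos :: "'n::finite \<Rightarrow> nat"
  assumes comp: "composition \<alpha>" and bij: "bij_betw pos UNIV {1..n}"
  shows "{v. v extreme_point_of (convex hull (vecs pos \<alpha>))} = vecs pos \<alpha>"
proof
  show "{v. v extreme_point_of (convex hull (vecs pos \<alpha>))} \<subseteq> vecs pos \<alpha>"
    using extreme_point_of_convex_hull by blast
  show "vecs pos \<alpha> \<subseteq> {v. v extreme_point_of (convex hull (vecs pos \<alpha>))}"
  proof
    fix v assume v: "v \<in> vecs pos \<alpha>"
    then obtain \<gamma> where \<gamma>: "v = real_vec \<gamma>" "delete_zeros pos \<gamma> = \<alpha>"
      by (auto simp: vecs_def)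
    \<comment> \<open>The inner product with \<open>u\<close> adds up the coordinates outside the
      support of \<open>\<gamma>\<close>.\<close>
    define u :: "real ^ 'n" where "u = (\<chi> j. if \<gamma> $ j = 0 then 1 else 0)"
    have u_inner: "u \<bullet> real_vec \<delta> = (\<Sum>j\<in>UNIV. if \<gamma> $ j = 0 then real (\<delta> $ j) else 0)" for \<delta>
      by (auto simp: inner_vec_def u_def intro: sum.cong)
    have v0: "u \<bullet> v = 0"
      unfolding \<gamma> u_inner by (rule sum.neutral) simp
    have "vecs pos \<alpha> - {v} \<subseteq> {x. u \<bullet> x > 0}"
    proof
      fix w assume w: "w \<in> vecs pos \<alpha> - {v}"
      then obtain \<delta> where \<delta>: "w = real_vec \<delta>" "delete_zeros pos \<delta> = \<alpha>"
        by (auto simp: vecs_def)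
      have "u \<bullet> w \<ge> 0"
        unfolding \<delta> u_inner by (rule sum_nonneg) simp
      moreover have "u \<bullet> w \<noteq> 0"
      proof
        assume "u \<bullet> w = 0"
        then have "\<forall>j\<in>UNIV. (if \<gamma> $ j = 0 then real (\<delta> $ j) else 0) = 0"
          unfolding \<delta> u_inner by (subst (asm) sum_nonneg_eq_0_iff) auto
        \<comment> \<open>A vanishing sum of nonnegative terms puts the support of
          \<open>\<delta>\<close> inside that of \<open>\<gamma>\<close>, as
          \<open>filter_nonzero_inj\<close> requires.\<close>
        then have sub: "\<delta> $ j = 0" if "\<gamma> $ j = 0" for j
          using that by (metis (full_types) UNIV_I of_nat_eq_0_iff)
        have "\<delta> $ j = \<gamma> $ j" for j
        proof -
          have "CARD('n) = n" and "inv pos (pos j) = j"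
            using bij_betw_same_card[OF bij] bij by (simp_all add: bij_betw_def)
          moreover have "pos j \<in> {1..n}"
            using bij by (auto simp: bij_betw_def)
          then have "pos j \<in> set [1..<Suc n]" by auto
          ultimately show ?thesis
            using filter_nonzero_inj[of "\<lambda>i. \<gamma> $ inv pos i" "[1..<Suc n]"
                "\<lambda>i. \<delta> $ inv pos i" "pos j"] sub \<gamma>(2) \<delta>(2)
            by (simp add: delete_zeros_def del: upt_Suc)
        qed
        then have "w = v" by (simp add: \<delta> \<gamma> vec_eq_iff)
        with w show False by simp
      qed
      ultimately show "w \<in> {x. u \<bullet> x > 0}" by simp
    qed
    \<comment> \<open>The open half-space is convex, so it contains the hull of all the other
      vectors, while \<open>v\<close> lies on its boundary hyperplane.\<close>
    then have "convex hull (vecs pos \<alpha> - {v}) \<subseteq> {x. u \<bullet> x > 0}"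
      by (intro hull_minimal convex_halfspace_gt)
    with v0 have "v \<notin> convex hull (vecs pos \<alpha> - {v})" by auto
    then have "v extreme_point_of (convex hull (insert v (vecs pos \<alpha> - {v})))"
      using finite_vecs[OF assms]
      by (intro extreme_point_of_convex_hull_insert) auto
    then show "v \<in> {v. v extreme_point_of (convex hull (vecs pos \<alpha>))}"
      using v by (simp add: insert_absorb)
  qed
qed

theorem theorem4p2:
  fixes \<alpha> :: "nat list" and n :: nat and pos :: "'n::finite \<Rightarrow> nat"
  assumes "composition \<alpha>"
    and "n \<ge> 1"
    and "bij_betw pos UNIV {1..n}"
  shows "newton pos (specialize n (fundamental_qsym \<alpha>)) = newton pos (specialize n (monomial_qsym \<alpha>))
    \<and> {v. v extreme_point_of newton pos (specialize n (monomial_qsym \<alpha>))}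
      = {(\<chi> j. real (\<gamma> $ j)) | \<gamma> :: nat ^ 'n. delete_zeros pos \<gamma> = \<alpha>}"
proof
  have M: "newton pos (specialize n (monomial_qsym \<alpha>)) = convex hull (vecs pos \<alpha>)"
    using exponent_vectors_monomial_qsym[OF assms(1,3)] by (simp add: newton_def)
  have F: "newton pos (specialize n (fundamental_qsym \<alpha>))
      = convex hull (\<Union>\<beta>\<in>refinements \<alpha>. vecs pos \<beta>)"
    using exponent_vectors_fundamental_qsym[OF assms(3)] by (simp add: newton_def)
  have "(\<Union>\<beta>\<in>refinements \<alpha>. vecs pos \<beta>) \<subseteq> convex hull (vecs pos \<alpha>)"
    using vecs_refinement[OF assms(3)] by (auto simp: refinements_def)
  \<comment> \<open>The empty chain of additions gives the inclusion of the polytope of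
    \<open>M\<^sub>\<alpha>\<close> in that of \<open>F\<^sub>\<alpha>\<close>.\<close>
  moreover have "\<alpha> \<in> refinements \<alpha>"
    using assms(1) by (simp add: refinements_def)
  then have "vecs pos \<alpha> \<subseteq> (\<Union>\<beta>\<in>refinements \<alpha>. vecs pos \<beta>)"
    by blast
  ultimately show "newton pos (specialize n (fundamental_qsym \<alpha>))
      = newton pos (specialize n (monomial_qsym \<alpha>))"
    unfolding M F by (intro equalityI hull_mono hull_minimal convex_convex_hull)
  show "{v. v extreme_point_of newton pos (specialize n (monomial_qsym \<alpha>))}
      = {(\<chi> j. real (\<gamma> $ j)) | \<gamma> :: nat ^ 'n. delete_zeros pos \<gamma> = \<alpha>}"
    unfolding M extreme_points_vecs[OF assms(1,3)] by (auto simp: vecs_def real_vec_def)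
qed

end
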